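(* For every integer $n\ge 2$, the number of bimonotone subdivisions of the $2\times n$ lattice grid $P_{n,n}$ is equal to $2^{n-2}S_{n-1}$, where $S_{n-1}$ is the $(n-1)$th large Schröder number.
   Context: The $2\times n$ lattice grid $P_{n,n}\subset\mathbb R^2$ is the point configuration $\{(i,j): 0\le i\le n-1,\ j\in\{0,1\}\}$. A subdivision of a finite point configuration $\mathcal A\subset\mathbb R^2$ is a collection of convex polygons (two-dimensional, with nonempty interior, regarded as convex sets) whose vertices lie in $\mathcal A$, such that the union of the polygons is the convex hull of $\mathcal A$ and each pair of distinct polygons either does not intersect or intersects exactly in a common vertex or a common side. Not all points of $\mathcal A$ need to be vertices of polygons. A polygon is bimonotone if every one of its edges is vertical or has nonnegative slope. A subdivision is bimonotone if all of its polygons are bimonotone. The $k$th large Schröder number $S_k$ is the number of lattice paths from $(0,0)$ to $(k,k)$ using unit steps north $(0,1)$, east $(1,0)$, or northeast $(1,1)$ such that no point of the path lies above the line $y=x$ (so $S_0=1$, $S_1=2$, $S_2=6$). *)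

theory Defs
  imports "HOL-Analysis.Analysis"
begin

definition lattice_grid :: "nat \<Rightarrow> (real \<times> real) set" where
  "lattice_grid n = {(real i, real j) | i j. i < n \<and> j \<in> {0, 1::nat}}"

definition convex_polygon :: "(real \<times> real) set \<Rightarrow> bool" where
  "convex_polygon P \<longleftrightarrow> polytope P \<and> interior P \<noteq> {}"

definition meet_properly :: "(real \<times> real) set \<Rightarrow> (real \<times> real) set \<Rightarrow> bool" where
  "meet_properly P Q \<longleftrightarrow>
     P \<inter> Q = {} \<or>
     (\<exists>v. v extreme_point_of P \<and> v extreme_point_of Q \<and> P \<inter> Q = {v}) \<or>
     (\<exists>e. e edge_of P \<and> e edge_of Q \<and> P \<inter> Q = e)"

text \<open>Vertices are extreme points: a point of \<open>A\<close> in the relative interior of a side of a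
  polygon is not a vertex of it, and two collections consisting of the same sets are the same
  subdivision.\<close>

definition subdivision :: "(real \<times> real) set \<Rightarrow> (real \<times> real) set set \<Rightarrow> bool" where
  "subdivision A T \<longleftrightarrow>
     (\<forall>P\<in>T. convex_polygon P \<and> {v. v extreme_point_of P} \<subseteq> A) \<and>
     \<Union>T = convex hull A \<and>
     (\<forall>P\<in>T. \<forall>Q\<in>T. P \<noteq> Q \<longrightarrow> meet_properly P Q)"

text \<open>Every edge of a polytope is a closed segment, so the quantifier below ranges over all edges.\<close>

definition bimonotone :: "(real \<times> real) set \<Rightarrow> bool" where
  "bimonotone P \<longleftrightarrow>
     (\<forall>a b. closed_segment a b edge_of P \<longrightarrow>
        fst a = fst b \<or> (snd b - snd a) / (fst b - fst a) \<ge> 0)"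

definition bimonotone_subdivision :: "(real \<times> real) set \<Rightarrow> (real \<times> real) set set \<Rightarrow> bool" where
  "bimonotone_subdivision A T \<longleftrightarrow> subdivision A T \<and> (\<forall>P\<in>T. bimonotone P)"

definition schroeder_step :: "nat \<times> nat \<Rightarrow> nat \<times> nat \<Rightarrow> bool" where
  "schroeder_step p q \<longleftrightarrow>
     (\<exists>d\<in>{(0, 1), (1, 0), (1, 1)}. q = (fst p + fst d, snd p + snd d))"

text \<open>A path is the list of lattice points it visits. The region \<open>y \<le> x\<close> is convex, so it
  suffices to constrain these points. Negative coordinates cannot occur, since no step
  decreases a coordinate.\<close>

definition schroeder_paths :: "nat \<Rightarrow> (nat \<times> nat) list set" where
  "schroeder_paths k =
     {ps. ps \<noteq> [] \<and> hd ps = (0, 0) \<and> last ps = (k, k) \<and>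
          successively schroeder_step ps \<and> (\<forall>(x, y)\<in>set ps. y \<le> x)}"

definition large_schroeder :: "nat \<Rightarrow> nat" where
  "large_schroeder k = card (schroeder_paths k)"

end

theory Submission imports Defs begin

text \<open>A polygon with vertices in the grid is a trapezoid, possibly degenerating to a triangle,
  between two segments that join a point \<open>(a, 0)\<close> to a point \<open>(c, 1)\<close>; it is bimonotone iff
  \<open>a \<le> c\<close> for both segments. Listing the segments from left to right identifies the bimonotone
  subdivisions with the chains of pairs \<open>(a, c)\<close>, \<open>a \<le> c \<le> m = n - 1\<close>, that run from \<open>(0, 0)\<close>
  to \<open>(m, m)\<close> in the product order.

  Both the chains and the Schroeder paths are counted by the kernel method. The number of
  completions from a point satisfies a linear recursion, which determines it, so it is
  enough to exhibit a solution. With \<open>S = 1 + t (S + S\<^sup>2)\<close> the generating function of the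
  Schroeder numbers, the paths from height \<open>h\<close> are given by \<open>t\<^sup>h S\<^sup>h\<^sup>+\<^sup>1\<close>. With
  \<open>Z = S (2 t)\<close> and \<open>Y = (1 + Z) / 2\<close>, the chains from \<open>(0, 0)\<close> are given by \<open>Y\<close>, whose
  coefficients are \<open>2 ^ (m - 1) * S\<^sub>m\<close> for \<open>m > 0\<close>.\<close>

section \<open>Counting paths and chains\<close>

text \<open>The recursion is S = 1 + t (S + S^2) read coefficient by coefficient. It is stated
  without lattice paths; agreement with \<open>large_schroeder\<close> comes out of the path
  count.\<close>

fun schroeder_num :: "nat \<Rightarrow> real" where
  "schroeder_num 0 = 1"
| "schroeder_num (Suc n) = schroeder_num n + (\<Sum>i\<le>n. schroeder_num i * schroeder_num (n - i))"

text \<open>This is S(c t). The scale \<open>c\<close> is 1 for the paths and 2 for the chains,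
  where it gives Z.\<close>

definition schroeder_fps :: "real \<Rightarrow> real fps" where
  "schroeder_fps c = Abs_fps (\<lambda>n. c ^ n * schroeder_num n)"

lemma schroeder_fps_eq:
  "schroeder_fps c = 1 + fps_const c * fps_X * (schroeder_fps c + schroeder_fps c ^ 2)"
proof (rule fps_ext)
  fix n
  show "fps_nth (schroeder_fps c) n =
    fps_nth (1 + fps_const c * fps_X * (schroeder_fps c + schroeder_fps c ^ 2)) n"
  proof (cases n)
    case 0
    then show ?thesis by (simp add: schroeder_fps_def)
  next
    case (Suc k)
    have "(\<Sum>i = 0..k. c ^ i * schroeder_num i * (c ^ (k - i) * schroeder_num (k - i)))
      = c ^ k * (\<Sum>i\<le>k. schroeder_num i * schroeder_num (k - i))"
      unfolding sum_distrib_left atMost_atLeast0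
      by (rule sum.cong) (auto simp: power_add[symmetric] algebra_simps)
    then show ?thesis using Suc
      by (simp add: schroeder_fps_def mult.assoc power2_eq_square fps_mult_nth[of "Abs_fps _" "Abs_fps _"] algebra_simps)
  qed
qed

section \<open>Lattice paths below the diagonal\<close>

definition schroeder_paths_from :: "nat \<Rightarrow> nat \<times> nat \<Rightarrow> (nat \<times> nat) list set" where
  "schroeder_paths_from k p =
     {ps. ps \<noteq> [] \<and> hd ps = p \<and> last ps = (k, k) \<and>
          successively schroeder_step ps \<and> (\<forall>(x, y)\<in>set ps. y \<le> x)}"

lemma successively_schroeder_step_mono:
  "successively schroeder_step ps \<Longrightarrow> ps \<noteq> [] \<Longrightarrow> hd ps \<le> last ps"
proof (induction ps rule: induct_list012)
  case (3 p q ps)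
  have "p \<le> q" using "3.prems" by (auto simp: schroeder_step_def less_eq_prod_def)
  with 3 show ?case by auto
qed auto

lemma schroeder_paths_from_empty:
  "\<not> p \<le> (k, k) \<or> fst p < snd p \<Longrightarrow> schroeder_paths_from k p = {}"
proof -
  assume p: "\<not> p \<le> (k, k) \<or> fst p < snd p"
  have "p \<le> (k, k) \<and> snd p \<le> fst p" if "ps \<in> schroeder_paths_from k p" for ps
    using that successively_schroeder_step_mono[of ps] hd_in_set[of ps]
    by (auto simp: schroeder_paths_from_def split: prod.splits)
  with p show ?thesis by (meson equals0I leD)
qed

lemma schroeder_paths_from_top: "schroeder_paths_from k (k, k) = {[(k, k)]}"
proof -
  have single: "qs = []" if "successively schroeder_step ((k, k) # qs)" "last ((k, k) # qs) = (k, k)" for qs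
  proof (cases qs)
    case (Cons q rs)
    with that have "schroeder_step (k, k) q" "q \<le> (k, k)"
      using successively_schroeder_step_mono[of qs] by auto
    then show ?thesis by (auto simp: schroeder_step_def)
  qed simp
  show ?thesis
  proof (intro equalityI subsetI)
    fix ps assume ps: "ps \<in> schroeder_paths_from k (k, k)"
    then obtain qs where qs: "ps = (k, k) # qs"
      by (cases ps) (auto simp: schroeder_paths_from_def)
    with ps have "qs = []"
      by (intro single) (auto simp: schroeder_paths_from_def)
    with qs show "ps \<in> {[(k, k)]}" by simp
  qed (simp add: schroeder_paths_from_def)
qed

lemma schroeder_paths_from_rec:
  assumes "p \<noteq> (k, k)" "snd p \<le> fst p"
  shows "schroeder_paths_from k p =
    (#) p ` (\<Union>d\<in>{(0, 1), (1, 0), (1, 1)}. schroeder_paths_from k (fst p + fst d, snd p + snd d))"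
    (is "?A = ?B")
proof (intro set_eqI iffI)
  fix ps assume ps: "ps \<in> ?A"
  then obtain qs where qs: "ps = p # qs" by (auto simp: schroeder_paths_from_def neq_Nil_conv)
  with ps assms have "qs \<noteq> []" by (auto simp: schroeder_paths_from_def)
  then obtain q rs where "qs = q # rs" by (auto simp: neq_Nil_conv)
  with ps qs have "schroeder_step p q" "qs \<in> schroeder_paths_from k q"
    by (auto simp: schroeder_paths_from_def)
  then show "ps \<in> ?B" unfolding qs schroeder_step_def by blast
next
  fix ps assume "ps \<in> ?B"
  then obtain d qs where "d \<in> {(0, 1), (1, 0), (1, 1)}" "ps = p # qs"
    "qs \<in> schroeder_paths_from k (fst p + fst d, snd p + snd d)" by blast
  then show "ps \<in> ?A"
    using assms(2) by (auto simp: schroeder_paths_from_def successively_Cons schroeder_step_def)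
qed

lemma card_schroeder_paths_from:
  assumes "y \<le> x" "y \<le> k"
  shows "finite (schroeder_paths_from k (x, y)) \<and>
    real (card (schroeder_paths_from k (x, y))) =
      fps_nth (fps_X ^ (x - y) * schroeder_fps 1 ^ Suc (x - y)) (k - y)"
  using assms
proof (induction "2 * k + 1 - x - y" arbitrary: x y rule: less_induct)
  case less
  define A where "A h = fps_X ^ h * schroeder_fps 1 ^ Suc h" for h
  define c where "c p = real (card (schroeder_paths_from k p))" for p
  consider "x > k" | "x = k" "y = k" | "x \<le> k" "y < k"
    using less.prems by linarith
  then show ?case
  proof cases
    case 1
    then show ?thesis using less.prems
      by (auto simp: schroeder_paths_from_empty less_eq_prod_def fps_X_power_mult_nth)
  next
    case 2
    then show ?thesis by (auto simp: schroeder_paths_from_top schroeder_fps_def)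
  next
    case 3
    have E: "finite (schroeder_paths_from k (x + 1, y))" "c (x + 1, y) = fps_nth (A (Suc (x - y))) (k - y)"
      using less.hyps[of "x + 1" y] less.prems 3 by (auto simp: c_def A_def Suc_diff_le)
    have D: "finite (schroeder_paths_from k (x + 1, y + 1))"
        "c (x + 1, y + 1) = fps_nth (A (x - y)) (k - y - 1)"
      using less.hyps[of "x + 1" "y + 1"] less.prems 3 by (auto simp: c_def A_def)
    have N: "finite (schroeder_paths_from k (x, y + 1))"
        "c (x, y + 1) = (if x = y then 0 else fps_nth (A (x - y - 1)) (k - y - 1))"
    proof -
      have "finite (schroeder_paths_from k (x, y + 1)) \<and>
          c (x, y + 1) = (if x = y then 0 else fps_nth (A (x - y - 1)) (k - y - 1))"
      proof (cases "x = y")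
        case True
        then show ?thesis by (simp add: c_def schroeder_paths_from_empty)
      next
        case False
        have "2 * k + 1 - x - (y + 1) < 2 * k + 1 - x - y" using 3 by linarith
        then show ?thesis
          using less.hyps[of x "y + 1"] less.prems 3 False by (simp add: c_def A_def)
      qed
      then show "finite (schroeder_paths_from k (x, y + 1))"
        "c (x, y + 1) = (if x = y then 0 else fps_nth (A (x - y - 1)) (k - y - 1))" by auto
    qed
    let ?D = "{(0, 1), (1, 0), (1, 1)} :: (nat \<times> nat) set"
    let ?P = "\<lambda>d. schroeder_paths_from k (x + fst d, y + snd d)"
    have rec: "schroeder_paths_from k (x, y) = (#) (x, y) ` (\<Union>d\<in>?D. ?P d)"
      using schroeder_paths_from_rec[of "(x, y)" k] less.prems 3 by simp
    have fin: "finite (?P d)" if "d \<in> ?D" for d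
      using that E(1) D(1) N(1) by auto
    have "card (schroeder_paths_from k (x, y)) = card (\<Union>d\<in>?D. ?P d)"
      unfolding rec by (rule card_image) simp
    also have "\<dots> = (\<Sum>d\<in>?D. card (?P d))"
    proof (rule card_UN_disjoint)
      show "\<forall>d\<in>?D. \<forall>e\<in>?D. d \<noteq> e \<longrightarrow> ?P d \<inter> ?P e = {}"
        by (auto simp: schroeder_paths_from_def)
    qed (use fin in auto)
    finally have card: "c (x, y) = c (x, y + 1) + c (x + 1, y) + c (x + 1, y + 1)"
      by (simp add: c_def)
    \<comment> \<open>This is the equation of S multiplied by t^h S^h. The three terms are the
      north, east and diagonal steps, with a factor t for each row climbed. For h = 0 the north step
      is forbidden and the constant 1 replaces it, which is invisible at the coefficient k - y >
      0.\<close>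
    have "A h = (if h = 0 then 1 else fps_X * A (h - 1)) + A (Suc h) + fps_X * A h" for h
    proof -
      let ?X = "schroeder_fps 1"
      have "fps_X ^ h * ?X ^ h * ?X = fps_X ^ h * ?X ^ h * (1 + fps_X * (?X + ?X ^ 2))"
        using schroeder_fps_eq[of 1] by simp
      then show ?thesis
        by (cases h) (auto simp: A_def algebra_simps power2_eq_square)
    qed
    from arg_cong[OF this, of "\<lambda>f. fps_nth f (k - y)" "x - y"]
    have "fps_nth (A (x - y)) (k - y) = c (x, y)"
      using 3 less.prems unfolding card E D N by auto
    moreover have "finite (schroeder_paths_from k (x, y))"
      unfolding rec using fin by blast
    ultimately show ?thesis by (simp add: c_def A_def)
  qed
qed

lemma large_schroeder_eq_schroeder_num: "real (large_schroeder k) = schroeder_num k"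
  using card_schroeder_paths_from[of 0 0 k]
  by (simp add: large_schroeder_def schroeder_paths_def schroeder_paths_from_def schroeder_fps_def)

section \<open>Chains of pairs in the product order\<close>

definition grid_chains_from :: "nat \<Rightarrow> nat \<times> nat \<Rightarrow> (nat \<times> nat) set set" where
  "grid_chains_from m p =
     {C. C \<subseteq> {(a, c). a \<le> c \<and> c \<le> m} \<and> (\<forall>q\<in>C. \<forall>r\<in>C. q \<le> r \<or> r \<le> q) \<and>
         p \<in> C \<and> (m, m) \<in> C \<and> (\<forall>q\<in>C. p \<le> q)}"

lemma finite_region: "finite {(a, c). a \<le> c \<and> c \<le> (m::nat)}"
  by (rule finite_subset[of _ "{..m} \<times> {..m}"]) auto

lemma finite_grid_chains_from: "finite (grid_chains_from m p)"
  by (rule finite_subset[of _ "Pow {(a, c). a \<le> c \<and> c \<le> m}"])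
    (auto simp: grid_chains_from_def finite_region)

lemma grid_chains_from_top: "grid_chains_from m (m, m) = {{(m, m)}}"
proof -
  have "C = {(m, m)}" if C: "C \<in> grid_chains_from m (m, m)" for C
  proof -
    have "q = (m, m)" if "q \<in> C" for q
    proof -
      have "(m, m) \<le> q" "fst q \<le> snd q" "snd q \<le> m"
        using C that by (auto simp: grid_chains_from_def)
      then show ?thesis by (cases q) (simp add: less_eq_prod_def)
    qed
    moreover have "(m, m) \<in> C" using C by (simp add: grid_chains_from_def)
    ultimately show ?thesis by blast
  qed
  moreover have "{(m, m)} \<in> grid_chains_from m (m, m)" by (simp add: grid_chains_from_def)
  ultimately show ?thesis by blast
qed

lemma finite_chain_has_least:
  fixes C :: "'a::order set"
  assumes "finite C" "C \<noteq> {}" "\<And>q r. q \<in> C \<Longrightarrow> r \<in> C \<Longrightarrow> q \<le> r \<or> r \<le> q"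
  shows "\<exists>p\<in>C. \<forall>q\<in>C. p \<le> q"
  using finite_has_minimal[OF assms(1,2)] assms(3) by metis

text \<open>Removing \<open>p\<close> leaves a chain that still contains \<open>(m, m)\<close>,
  hence has a least element, and this is the \<open>q\<close>.\<close>

lemma grid_chains_from_rec:
  assumes "p \<noteq> (m, m)" "fst p \<le> snd p" "snd p \<le> m"
  shows "grid_chains_from m p =
    insert p ` (\<Union>q\<in>{(a, c). a \<le> c \<and> c \<le> m \<and> p < (a, c)}. grid_chains_from m q)" (is "_ = ?B")
proof (intro set_eqI iffI)
  fix C assume C: "C \<in> grid_chains_from m p"
  have "finite C" using C finite_subset[OF _ finite_region]
    by (auto simp: grid_chains_from_def)
  moreover have "(m, m) \<in> C - {p}" using C assms(1) by (auto simp: grid_chains_from_def)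
  ultimately have "\<exists>q\<in>C - {p}. \<forall>r\<in>C - {p}. q \<le> r"
    using C by (intro finite_chain_has_least) (auto simp: grid_chains_from_def)
  then obtain q where q: "q \<in> C - {p}" "\<forall>r\<in>C - {p}. q \<le> r" by blast
  have "C - {p} \<in> grid_chains_from m q"
    using C q \<open>(m, m) \<in> C - {p}\<close> by (auto simp: grid_chains_from_def)
  moreover have "q \<in> {(a, c). a \<le> c \<and> c \<le> m \<and> p < (a, c)}"
    using C q by (auto simp: grid_chains_from_def order.strict_iff_order)
  moreover have "C = insert p (C - {p})" using C by (auto simp: grid_chains_from_def)
  ultimately show "C \<in> ?B" by blast
next
  fix C assume "C \<in> ?B"
  then obtain q D where D: "C = insert p D" "p < q" "D \<in> grid_chains_from m q" by blast
  then have "\<forall>r\<in>D. p \<le> r" by (auto simp: grid_chains_from_def)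
  with D assms show "C \<in> grid_chains_from m p"
    by (auto simp: grid_chains_from_def)
qed

text \<open>A chain determines its least element, so the union over \<open>q\<close> is disjoint; no
  chain from \<open>q > p\<close> contains \<open>p\<close>, so \<open>insert p\<close> is injective
  on it.\<close>

lemma card_grid_chains_from_rec:
  assumes "p \<noteq> (m, m)" "fst p \<le> snd p" "snd p \<le> m"
  shows "card (grid_chains_from m p) =
    (\<Sum>q\<in>{(a, c). a \<le> c \<and> c \<le> m \<and> p < (a, c)}. card (grid_chains_from m q))"
proof -
  let ?Q = "{(a, c). a \<le> c \<and> c \<le> m \<and> p < (a, c)}"
  have notin: "p \<notin> D" if "q \<in> ?Q" "D \<in> grid_chains_from m q" for q D
    using that by (auto simp: grid_chains_from_def)
  have "inj_on (insert p) (\<Union>q\<in>?Q. grid_chains_from m q)"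
    using notin by (intro inj_onI) (metis (no_types, lifting) UN_E insert_ident)
  then have "card (grid_chains_from m p) = card (\<Union>q\<in>?Q. grid_chains_from m q)"
    unfolding grid_chains_from_rec[OF assms] by (rule card_image)
  also have "\<dots> = (\<Sum>q\<in>?Q. card (grid_chains_from m q))"
  proof (rule card_UN_disjoint)
    show "finite ?Q" by (rule finite_subset[OF _ finite_region[of m]]) auto
    show "\<forall>q\<in>?Q. \<forall>r\<in>?Q. q \<noteq> r \<longrightarrow> grid_chains_from m q \<inter> grid_chains_from m r = {}"
      unfolding grid_chains_from_def by (force intro: order.antisym)
  qed (simp add: finite_grid_chains_from)
  finally show ?thesis .
qed

section \<open>Generating functions that solve the chain recursion\<close>

definition half_fps :: "real fps" where
  "half_fps = fps_const (1/2) * (1 + schroeder_fps 2)"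

lemma two_half_fps: "2 * half_fps = 1 + schroeder_fps 2"
proof -
  have "(2::real fps) * fps_const (1/2) = 1"
    by (simp add: numeral_fps_const fps_const_mult flip: fps_const_1_eq_1)
  then show ?thesis by (simp add: half_fps_def mult.assoc[symmetric])
qed

text \<open>With \<open>h = c - a\<close>, the coefficients of \<open>col_fps h\<close> and \<open>quad_fps h\<close> at \<open>m - a\<close> are the
  sums of the numbers of chains starting in the column \<open>{(a', c). a \<le> a'}\<close> and in the
  quadrant \<open>{(a', c'). a \<le> a' \<and> c \<le> c'}\<close>.\<close>

definition col_fps :: "nat \<Rightarrow> real fps" where
  "col_fps h = (2 * fps_X) ^ h * half_fps ^ Suc h"

definition quad_fps :: "nat \<Rightarrow> real fps" where
  "quad_fps h = (2 * fps_X) ^ h * half_fps ^ h * schroeder_fps 2"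

text \<open>Up to the factor (2 t Y)^h the claim is Z = 2 t Y Z + Y. It follows from Z = 1 + 2 t Z
  (1 + Z) = 1 + 4 t Y Z by adding Z on both sides and halving.\<close>

lemma quad_fps_diff: "quad_fps h = quad_fps (Suc h) + col_fps h"
proof -
  let ?Z = "schroeder_fps 2"
  have "?Z = 1 + 2 * fps_X * (?Z + ?Z ^ 2)"
    using schroeder_fps_eq[of 2] by (simp add: numeral_fps_const)
  then have "2 * ?Z = 2 * (2 * fps_X * half_fps * ?Z + half_fps)"
    using two_half_fps by algebra
  then have "?Z = 2 * fps_X * half_fps * ?Z + half_fps" by (simp del: distrib_left_numeral)
  then have "quad_fps h = (2 * fps_X) ^ h * half_fps ^ h * (2 * fps_X * half_fps * ?Z + half_fps)"
    by (simp add: quad_fps_def)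
  then show ?thesis by (simp add: quad_fps_def col_fps_def algebra_simps)
qed

text \<open>By the chain recursion the number at p is the sum over all q > p, so the sum over all q
  >= p is twice that number. The two parts express this for points with h = 0 and with h > 0; the
  constant 1 corrects for \<open>(m, m)\<close>, where the recursion stops.\<close>

lemma quad_fps_double:
  "quad_fps 0 + 1 = 2 * col_fps 0"
  "quad_fps (Suc h) = 2 * (col_fps (Suc h) - fps_X * col_fps h)"
proof -
  show "quad_fps 0 + 1 = 2 * col_fps 0"
    by (simp add: quad_fps_def col_fps_def two_half_fps)
  have eq: "schroeder_fps 2 = 2 * half_fps - 1" by (simp only: two_half_fps add_diff_cancel_left')
  show "quad_fps (Suc h) = 2 * (col_fps (Suc h) - fps_X * col_fps h)"
    unfolding quad_fps_def col_fps_def power_Suc eq by (simp add: algebra_simps)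
qed

text \<open>The number at one point is the difference of two consecutive column sums. Passing from a
  to a + 1 lowers both h = c - a and m - a by one; for a = c the column is a single point and
  nothing is subtracted.\<close>

definition chain_coeff :: "nat \<Rightarrow> nat \<times> nat \<Rightarrow> real" where
  "chain_coeff m = (\<lambda>(a, c). fps_nth (col_fps (c - a)) (m - a)
     - (if a < c then fps_nth (col_fps (c - Suc a)) (m - Suc a) else 0))"

lemma sum_chain_coeff_column:
  assumes "a \<le> c"
  shows "(\<Sum>a'=a..c. chain_coeff m (a', c)) = fps_nth (col_fps (c - a)) (m - a)"
  using assms
proof (induction a rule: inc_induct)
  case base
  then show ?case by (simp add: chain_coeff_def)
next
  case (step a)
  then show ?case by (subst sum.atLeast_Suc_atMost) (auto simp: chain_coeff_def)
qed

text \<open>The column sums telescope by \<open>quad_fps_diff\<close>. The remainder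
  \<open>quad_fps (Suc m - a)\<close> is divisible by t^(m + 1 - a), so it has no coefficient at m -
  a.\<close>

lemma sum_chain_coeff:
  assumes "a \<le> c" "c \<le> m"
  shows "(\<Sum>q\<in>{(a', c'). a' \<le> c' \<and> c' \<le> m \<and> (a, c) \<le> (a', c')}. chain_coeff m q)
    = fps_nth (quad_fps (c - a)) (m - a)"
proof -
  \<comment> \<open>Allowing \<open>c = Suc m\<close> lets the downward induction start at the empty
    sum.\<close>
  have "(\<Sum>c'=c..m. fps_nth (col_fps (c' - a)) (m - a)) =
      fps_nth (quad_fps (c - a)) (m - a) - fps_nth (quad_fps (Suc m - a)) (m - a)"
    if "a \<le> c" "c \<le> Suc m" for c
    using that(2,1)
  proof (induction c rule: inc_induct)
    case base
    then show ?case by simp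
  next
    case (step c)
    have "{c..m} = insert c {Suc c..m}" using step.hyps by auto
    then show ?case
      using step arg_cong[OF quad_fps_diff[of "c - a"], of "\<lambda>f. fps_nth f (m - a)"]
      by (simp add: Suc_diff_le)
  qed
  moreover have "fps_nth (quad_fps (Suc m - a)) (m - a) = 0"
  proof -
    have "quad_fps h = fps_X ^ h * (2 ^ h * half_fps ^ h * schroeder_fps 2)" for h
      by (simp add: quad_fps_def power_mult_distrib algebra_simps)
    then show ?thesis using assms by (simp only: fps_X_power_mult_nth) simp
  qed
  moreover have "(\<Sum>q\<in>{(a', c'). a' \<le> c' \<and> c' \<le> m \<and> (a, c) \<le> (a', c')}. chain_coeff m q)
    = (\<Sum>c'=c..m. \<Sum>a'=a..c'. chain_coeff m (a', c'))"
    unfolding sum.Sigma[OF finite_atLeastAtMost ballI[OF finite_atLeastAtMost]]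
    by (rule sum.reindex_bij_witness[of _ "\<lambda>(c', a'). (a', c')" "\<lambda>(a', c'). (c', a')"]) auto
  ultimately show ?thesis
    using assms by (simp add: sum_chain_coeff_column)
qed

lemma card_grid_chains_from:
  assumes "a \<le> c" "c \<le> m"
  shows "real (card (grid_chains_from m (a, c))) = chain_coeff m (a, c)"
  using assms
proof (induction "2 * m - a - c" arbitrary: a c rule: less_induct)
  case less
  let ?S = "{(a', c'). a' \<le> c' \<and> c' \<le> m \<and> (a, c) \<le> (a', c')}"
  let ?Q = "{(a', c'). a' \<le> c' \<and> c' \<le> m \<and> (a, c) < (a', c')}"
  have eq: "?S = insert (a, c) ?Q" "(a, c) \<notin> ?Q" using less.prems by (auto simp: order.strict_iff_order)
  have fin: "finite ?Q" by (rule finite_subset[OF _ finite_region[of m]]) auto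
  have "fps_nth (quad_fps (c - a)) (m - a) = chain_coeff m (a, c) + (\<Sum>q\<in>?Q. chain_coeff m q)"
    using sum_chain_coeff[OF less.prems] eq fin by simp
  \<comment> \<open>The \<open>of_bool\<close> term is the constant 1 of
    \<open>quad_fps_double(1)\<close>, which is seen only at the coefficient m - a = 0.\<close>
  moreover have "fps_nth (quad_fps (c - a)) (m - a) + of_bool (a = m) = 2 * chain_coeff m (a, c)"
  proof (cases "a = c")
    case True
    then show ?thesis using less.prems
      arg_cong[OF quad_fps_double(1), of "\<lambda>f. fps_nth f (m - a)"]
      by (auto simp: chain_coeff_def numeral_fps_const)
  next
    case False
    define h where "h = c - Suc a"
    have "a < c" "c - a = Suc h" "a \<noteq> m" using False less.prems by (auto simp: h_def)
    then show ?thesis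
      using less.prems quad_fps_double(2)[of h]
      by (simp add: chain_coeff_def numeral_fps_const flip: h_def)
  qed
  ultimately have main: "(\<Sum>q\<in>?Q. chain_coeff m q) + of_bool (a = m) = chain_coeff m (a, c)" by simp
  show ?case
  proof (cases "a = m")
    case True
    then have "?Q = {}" "c = m" using less.prems by (auto simp: less_prod_def)
    then have "chain_coeff m (a, c) = 1" using main unfolding \<open>?Q = {}\<close> by (simp add: True)
    then show ?thesis using True \<open>c = m\<close> by (simp add: grid_chains_from_top)
  next
    case False
    have "real (card (grid_chains_from m (a, c))) = (\<Sum>q\<in>?Q. real (card (grid_chains_from m q)))"
      using card_grid_chains_from_rec[of "(a, c)" m] less.prems False by simp
    also have "\<dots> = (\<Sum>q\<in>?Q. chain_coeff m q)"
    proof (rule sum.cong)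
      fix q assume "q \<in> ?Q"
      then show "real (card (grid_chains_from m q)) = chain_coeff m q"
        using less.hyps[of "fst q" "snd q"] less.prems by (auto simp: less_prod_def)
    qed simp
    finally show ?thesis using main False by simp
  qed
qed

lemma card_grid_chains:
  assumes "m \<ge> 1"
  shows "card (grid_chains_from m (0, 0)) = 2 ^ (m - 1) * large_schroeder m"
proof -
  have "real (card (grid_chains_from m (0, 0))) = fps_nth half_fps m"
    using card_grid_chains_from[of 0 0 m] by (simp add: chain_coeff_def col_fps_def)
  also have "\<dots> = real (2 ^ (m - 1) * large_schroeder m)"
    using assms by (cases m) (auto simp: half_fps_def schroeder_fps_def large_schroeder_eq_schroeder_num)
  finally show ?thesis by linarith
qed

section \<open>Trapezoids\<close>

text \<open>The first coordinate, at height v, of the line through the lower point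
  \<open>fst p\<close> and the upper point \<open>snd p\<close>.\<close>

definition abscissa :: "real \<Rightarrow> nat \<times> nat \<Rightarrow> real" where
  "abscissa v p = (1 - v) * real (fst p) + v * real (snd p)"

definition side :: "nat \<times> nat \<Rightarrow> (real \<times> real) set" where
  "side p = closed_segment (real (fst p), 0) (real (snd p), 1)"

text \<open>Given by its horizontal slices, so that covering and overlapping become questions about
  intervals at a fixed height.\<close>

definition trapezoid :: "nat \<times> nat \<Rightarrow> nat \<times> nat \<Rightarrow> (real \<times> real) set" where
  "trapezoid p q = {(u, v). 0 \<le> v \<and> v \<le> 1 \<and> abscissa v p \<le> u \<and> u \<le> abscissa v q}"

lemma abscissa_0 [simp]: "abscissa 0 p = real (fst p)" and abscissa_1 [simp]: "abscissa 1 p = real (snd p)"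
  by (auto simp: abscissa_def)

lemma abscissa_diag [simp]: "abscissa v (k, k) = real k"
  by (simp add: abscissa_def algebra_simps)

lemma abscissa_mono: "p \<le> q \<Longrightarrow> 0 \<le> v \<Longrightarrow> v \<le> 1 \<Longrightarrow> abscissa v p \<le> abscissa v q"
  unfolding abscissa_def less_eq_prod_def by (intro add_mono mult_left_mono) auto

lemma abscissa_strict_mono:
  assumes "p < q" "0 < v" "v < 1"
  shows "abscissa v p < abscissa v q"
proof (cases "fst p < fst q")
  case True
  then show ?thesis using assms unfolding abscissa_def less_prod_def less_eq_prod_def
    by (intro add_less_le_mono mult_strict_left_mono mult_left_mono) auto
next
  case False
  then have "snd p < snd q" using assms(1) by (auto simp: less_prod_def less_eq_prod_def)
  then show ?thesis using assms unfolding abscissa_def less_prod_def less_eq_prod_def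
    by (intro add_le_less_mono mult_strict_left_mono mult_left_mono) auto
qed

text \<open>Equality of the abscissae is a relation v d = e with integers d and e, and an irrational
  v forces d = e = 0.\<close>

lemma abscissa_inj:
  assumes "v \<notin> \<rat>" "abscissa v p = abscissa v q"
  shows "p = q"
proof -
  let ?d = "(real (snd p) - real (fst p)) - (real (snd q) - real (fst q))"
  have eq: "v * ?d = real (fst q) - real (fst p)"
    using assms(2) by (simp add: abscissa_def algebra_simps)
  have "?d = 0"
  proof (rule ccontr)
    assume d: "?d \<noteq> 0"
    have "v = (real (fst q) - real (fst p)) / ?d"
      using d eq by (simp only: eq_divide_eq) simp
    moreover have "(real (fst q) - real (fst p)) / ?d \<in> \<rat>"
      by (intro Rats_divide Rats_diff) auto
    ultimately show False using assms(1) by simp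
  qed
  with eq show ?thesis by (simp add: prod_eq_iff)
qed

lemma mem_side: "x \<in> side p \<longleftrightarrow> 0 \<le> snd x \<and> snd x \<le> 1 \<and> fst x = abscissa (snd x) p"
  by (cases x) (auto simp: side_def in_segment abscissa_def)

text \<open>The inner product form yields convexity and the supporting lines that cut out the two
  sides as faces.\<close>

lemma trapezoid_halfspaces:
  "trapezoid p q = {x. (0, 1) \<bullet> x \<ge> 0} \<inter> {x. (0, 1) \<bullet> x \<le> 1} \<inter>
     {x. (1, real (fst p) - real (snd p)) \<bullet> x \<ge> real (fst p)} \<inter>
     {x. (1, real (fst q) - real (snd q)) \<bullet> x \<le> real (fst q)}"
proof -
  have "abscissa v r \<le> u \<longleftrightarrow> real (fst r) \<le> u + (real (fst r) - real (snd r)) * v"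
    "u \<le> abscissa v r \<longleftrightarrow> u + (real (fst r) - real (snd r)) * v \<le> real (fst r)" for u v r
    unfolding abscissa_def by (simp_all only: left_diff_distrib mult.commute[of v]) linarith+
  then show ?thesis by (auto simp: trapezoid_def)
qed

lemma convex_trapezoid: "convex (trapezoid p q)"
  unfolding trapezoid_halfspaces
  by (intro convex_Int convex_halfspace_le convex_halfspace_ge)

definition corners :: "nat \<times> nat \<Rightarrow> nat \<times> nat \<Rightarrow> (real \<times> real) set" where
  "corners p q = {(real (fst p), 0), (real (snd p), 1), (real (fst q), 0), (real (snd q), 1)}"

text \<open>Each point lies on a horizontal segment between the two sides, and the sides lie in the
  hull of their end points.\<close>

lemma trapezoid_eq_hull:
  assumes "p \<le> q"
  shows "trapezoid p q = convex hull (corners p q)"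
proof
  show "convex hull (corners p q) \<subseteq> trapezoid p q"
    using assms by (intro hull_minimal convex_trapezoid) (auto simp: trapezoid_def corners_def less_eq_prod_def)
  show "trapezoid p q \<subseteq> convex hull (corners p q)"
  proof
    fix x assume x: "x \<in> trapezoid p q"
    obtain u v where [simp]: "x = (u, v)" by fastforce
    have sides: "side p \<subseteq> convex hull (corners p q)" "side q \<subseteq> convex hull (corners p q)"
      unfolding side_def by (intro closed_segment_subset convex_convex_hull hull_inc; simp add: corners_def)+
    have "(abscissa v p, v) \<in> side p" "(abscissa v q, v) \<in> side q"
      using x by (auto simp: mem_side trapezoid_def)
    moreover have "x \<in> closed_segment (abscissa v p, v) (abscissa v q, v)"
      using x by (auto simp: trapezoid_def closed_segment_same_snd closed_segment_eq_real_ivl)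
    ultimately show "x \<in> convex hull (corners p q)"
      using closed_segment_subset[OF _ _ convex_convex_hull] sides by blast
  qed
qed

text \<open>The corners of each trapezoid lie in the other; at heights 0 and 1 this gives
  inequalities in both directions.\<close>

lemma trapezoid_inj:
  assumes "trapezoid p q = trapezoid p' q'" "p \<le> q" "p' \<le> q'"
  shows "p = p' \<and> q = q'"
proof -
  have "corners p q \<subseteq> trapezoid p' q'" "corners p' q' \<subseteq> trapezoid p q"
    using assms trapezoid_eq_hull hull_subset by metis+
  then show ?thesis
    by (auto simp: corners_def trapezoid_def prod_eq_iff)
qed

lemma interior_trapezoid:
  assumes "0 < v" "v < 1" "abscissa v p < u" "u < abscissa v q"
  shows "(u, v) \<in> interior (trapezoid p q)"
proof (rule interiorI)
  let ?U = "{x. 0 < snd x} \<inter> {x. snd x < 1} \<inter> {x. abscissa (snd x) p < fst x} \<inter> {x. fst x < abscissa (snd x) q}"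
  show "open ?U" unfolding abscissa_def
    by (intro open_Int open_Collect_less continuous_intros)
  show "(u, v) \<in> ?U" "?U \<subseteq> trapezoid p q" using assms by (auto simp: trapezoid_def)
qed

lemma interior_trapezoid_nonempty:
  assumes "p < q"
  shows "interior (trapezoid p q) \<noteq> {}"
proof -
  have "abscissa (1/2) p < abscissa (1/2) q" using abscissa_strict_mono[OF assms] by simp
  then obtain u where "abscissa (1/2) p < u" "u < abscissa (1/2) q" using dense by blast
  then show ?thesis using interior_trapezoid[of "1/2" p u q] by auto
qed

lemma convex_polygon_trapezoid: "p < q \<Longrightarrow> convex_polygon (trapezoid p q)"
  unfolding convex_polygon_def polytope_def
  using interior_trapezoid_nonempty[of p q] trapezoid_eq_hull[OF less_imp_le]
  by (metis corners_def finite.emptyI finite.insertI)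

lemma extreme_point_of_trapezoid: "p \<le> q \<Longrightarrow> x extreme_point_of trapezoid p q \<Longrightarrow> x \<in> corners p q"
  by (metis trapezoid_eq_hull extreme_point_of_convex_hull)

lemma side_edge_of_trapezoid:
  assumes "p \<le> q"
  shows "side p edge_of trapezoid p q" "side q edge_of trapezoid p q"
proof -
  have dim: "aff_dim (side r) = 1" for r
    by (simp add: side_def segment_convex_hull aff_dim_convex_hull)
  have "trapezoid p q \<inter> {x. (1, real (fst p) - real (snd p)) \<bullet> x = real (fst p)} face_of trapezoid p q"
    by (rule face_of_Int_supporting_hyperplane_ge[OF convex_trapezoid]) (auto simp: trapezoid_halfspaces)
  moreover have "trapezoid p q \<inter> {x. (1, real (fst p) - real (snd p)) \<bullet> x = real (fst p)} = side p"
    using abscissa_mono[OF assms] by (auto simp: trapezoid_def mem_side) (auto simp: abscissa_def algebra_simps)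
  ultimately show "side p edge_of trapezoid p q" by (simp add: edge_of_def dim)
  have "trapezoid p q \<inter> {x. (1, real (fst q) - real (snd q)) \<bullet> x = real (fst q)} face_of trapezoid p q"
    by (rule face_of_Int_supporting_hyperplane_le[OF convex_trapezoid]) (auto simp: trapezoid_halfspaces)
  moreover have "trapezoid p q \<inter> {x. (1, real (fst q) - real (snd q)) \<bullet> x = real (fst q)} = side q"
    using abscissa_mono[OF assms] by (auto simp: trapezoid_def mem_side) (auto simp: abscissa_def algebra_simps)
  ultimately show "side q edge_of trapezoid p q" by (simp add: edge_of_def dim)
qed

lemma corner_extreme_point_of_trapezoid:
  assumes "p \<le> q" "x \<in> corners p q"
  shows "x extreme_point_of trapezoid p q"
proof -
  have "y extreme_point_of trapezoid p q" if "r \<in> {p, q}" "y = (real (fst r), 0) \<or> y = (real (snd r), 1)" for r y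
    using that side_edge_of_trapezoid[OF assms(1)] extreme_point_of_segment[of y]
    by (metis edge_of_def extreme_point_of_face insertE side_def singletonD)
  then show ?thesis using assms(2) unfolding corners_def by blast
qed

text \<open>If the midpoint of the segment lay strictly between the sides, it would be an interior
  point and the face would be the whole two-dimensional trapezoid.\<close>

lemma segment_edge_of_trapD:
  assumes "p < q" "closed_segment (s, 0) (t, 1) edge_of trapezoid p q"
  shows "closed_segment (s, 0) (t, 1) = side p \<or> closed_segment (s, 0) (t, 1) = side q"
proof -
  let ?S = "closed_segment (s, 0) (t, 1)" and ?w = "((s + t) / 2, 1 / 2 :: real)"
  let ?l = "(abscissa (1/2) p, 1/2 :: real)" and ?r = "(abscissa (1/2) q, 1/2 :: real)"
  have face: "?S face_of trapezoid p q" using assms(2) by (simp add: edge_of_def)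
  have ends: "(s, 0) \<in> trapezoid p q" "(t, 1) \<in> trapezoid p q"
    using face_of_imp_subset[OF face] by auto
  have w: "?w \<in> ?S" unfolding in_segment by (rule exI[of _ "1/2"]) (simp add: field_simps)
  have lr: "?l \<in> trapezoid p q" "?r \<in> trapezoid p q"
    using abscissa_mono[of p q "1/2"] assms(1) by (auto simp: trapezoid_def)
  have "\<not> (abscissa (1/2) p < (s + t) / 2 \<and> (s + t) / 2 < abscissa (1/2) q)"
  proof
    assume *: "abscissa (1/2) p < (s + t) / 2 \<and> (s + t) / 2 < abscissa (1/2) q"
    then have "?w \<in> interior (trapezoid p q)" by (intro interior_trapezoid) auto
    then have "?S = trapezoid p q" using face_of_disjoint_interior[OF face] w by blast
    then show False
      using assms(2) aff_dim_nonempty_interior[OF interior_trapezoid_nonempty[OF assms(1)]]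
      by (simp add: edge_of_def)
  qed
  then have "abscissa (1/2) p \<ge> (s + t) / 2 \<or> abscissa (1/2) q \<le> (s + t) / 2" by linarith
  \<comment> \<open>Both ends lie in the trapezoid, so the midpoint can reach a side only if both
    ends are on that side.\<close>
  then have "s = fst p \<and> t = snd p \<or> s = fst q \<and> t = snd q"
    using ends by (auto simp: trapezoid_def abscissa_def)
  then show ?thesis by (auto simp: side_def)
qed

text \<open>Both sides are edges even when the trapezoid is a triangle. The ends of any edge are
  corners, so an edge is either horizontal, with slope 0, or joins the two rows and is then one of
  the sides.\<close>

lemma bimonotone_trapezoid:
  assumes "p < q"
  shows "bimonotone (trapezoid p q) \<longleftrightarrow> fst p \<le> snd p \<and> fst q \<le> snd q"
proof
  assume bm: "bimonotone (trapezoid p q)"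
  have "fst r \<le> snd r" if "side r edge_of trapezoid p q" for r
    using bm that unfolding bimonotone_def side_def by (fastforce simp: field_simps)
  then show "fst p \<le> snd p \<and> fst q \<le> snd q"
    using side_edge_of_trapezoid assms by (simp add: order.strict_iff_order)
next
  assume le: "fst p \<le> snd p \<and> fst q \<le> snd q"
  have up: "s \<le> t" if "closed_segment (s, 0) (t, 1) edge_of trapezoid p q" for s t
    using segment_edge_of_trapD[OF assms that] le
    by (auto simp: side_def closed_segment_eq doubleton_eq_iff)
  show "bimonotone (trapezoid p q)"
    unfolding bimonotone_def
  proof (intro allI impI)
    fix x y assume xy: "closed_segment x y edge_of trapezoid p q"
    have corners: "z \<in> corners p q" if "z \<in> {x, y}" for z
    proof -
      have "z extreme_point_of closed_segment x y" using that by (simp add: extreme_point_of_segment)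
      then show ?thesis using xy extreme_point_of_trapezoid[of p q z] assms
        by (auto simp: edge_of_def extreme_point_of_face)
    qed
    have "snd x \<in> {0, 1}" "snd y \<in> {0, 1}"
      using corners[of x] corners[of y] by (auto simp: corners_def)
    then consider "snd x = snd y" | "snd x = 0" "snd y = 1" | "snd x = 1" "snd y = 0" by auto
    then show "fst x = fst y \<or> (snd y - snd x) / (fst y - fst x) \<ge> 0"
    proof cases
      case 2
      then show ?thesis using up[of "fst x" "fst y"] xy by (cases x; cases y) auto
    next
      case 3
      then show ?thesis using up[of "fst y" "fst x"] xy
        by (cases x; cases y) (auto simp: closed_segment_commute divide_simps)
    qed simp
  qed
qed

text \<open>The trapezoids meet exactly at the heights where \<open>q\<close> and \<open>p'\<close>
  have equal abscissae. The gap is a sum of two nonnegative terms, with factors 1 - v and v, so it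
  vanishes at all heights, only at v = 0, only at v = 1, or never: a common side, a common vertex,
  or no intersection.\<close>

lemma trapezoid_meet_properly:
  assumes "p < q" "q \<le> p'" "p' < q'"
  shows "meet_properly (trapezoid p q) (trapezoid p' q')"
proof -
  have I: "x \<in> trapezoid p q \<inter> trapezoid p' q' \<longleftrightarrow>
      0 \<le> snd x \<and> snd x \<le> 1 \<and> fst x = abscissa (snd x) q \<and> abscissa (snd x) q = abscissa (snd x) p'" for x
    using abscissa_mono[of p q "snd x"] abscissa_mono[of q p' "snd x"] abscissa_mono[of p' q' "snd x"] assms
    by (cases x) (auto simp: trapezoid_def)
  have eq: "abscissa v q = abscissa v p' \<longleftrightarrow> (1 - v) * (real (fst p') - real (fst q)) = 0 \<and> v * (real (snd p') - real (snd q)) = 0"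
    if "0 \<le> v" "v \<le> 1" for v
  proof -
    have "(1 - v) * (real (fst p') - real (fst q)) \<ge> 0" "v * (real (snd p') - real (snd q)) \<ge> 0"
      using that assms(2) by (auto simp: less_eq_prod_def)
    moreover have "abscissa v p' - abscissa v q =
        (1 - v) * (real (fst p') - real (fst q)) + v * (real (snd p') - real (snd q))"
      by (simp add: abscissa_def algebra_simps)
    ultimately show ?thesis by linarith
  qed
  consider "q = p'" | "fst q = fst p'" "snd q \<noteq> snd p'" | "fst q \<noteq> fst p'" "snd q = snd p'"
    | "fst q \<noteq> fst p'" "snd q \<noteq> snd p'" by (auto simp: prod_eq_iff)
  then show ?thesis
  proof cases
    case 1
    then have "trapezoid p q \<inter> trapezoid p' q' = side q" using I by (simp only: set_eq_iff mem_side) simp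
    then show ?thesis
      using side_edge_of_trapezoid(2)[of p q] side_edge_of_trapezoid(1)[of p' q'] assms 1
      unfolding meet_properly_def by auto
  next
    case 2
    then have v: "abscissa v q = abscissa v p' \<longleftrightarrow> v = 0" if "0 \<le> v" "v \<le> 1" for v
      using eq[OF that] by auto
    have "trapezoid p q \<inter> trapezoid p' q' = {(real (fst q), 0)}"
    proof (intro equalityI subsetI)
      fix x assume "x \<in> trapezoid p q \<inter> trapezoid p' q'"
      then have "snd x = 0" "fst x = abscissa (snd x) q" using v by (auto simp only: I)
      then show "x \<in> {(real (fst q), 0)}" by (simp add: prod_eq_iff)
    next
      fix x :: "real \<times> real" assume "x \<in> {(real (fst q), 0)}"
      then show "x \<in> trapezoid p q \<inter> trapezoid p' q'" unfolding I using v[of "snd x"] by auto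
    qed
    moreover have "(real (fst q), 0) \<in> corners p q \<inter> corners p' q'" using 2 by (simp add: corners_def)
    ultimately show ?thesis
      using corner_extreme_point_of_trapezoid assms unfolding meet_properly_def by (auto dest!: less_imp_le)
  next
    case 3
    then have v: "abscissa v q = abscissa v p' \<longleftrightarrow> v = 1" if "0 \<le> v" "v \<le> 1" for v
      using eq[OF that] by auto
    have "trapezoid p q \<inter> trapezoid p' q' = {(real (snd q), 1)}"
    proof (intro equalityI subsetI)
      fix x assume "x \<in> trapezoid p q \<inter> trapezoid p' q'"
      then have "snd x = 1" "fst x = abscissa (snd x) q" using v by (auto simp only: I)
      then show "x \<in> {(real (snd q), 1)}" by (simp add: prod_eq_iff)
    next
      fix x :: "real \<times> real" assume "x \<in> {(real (snd q), 1)}"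
      then show "x \<in> trapezoid p q \<inter> trapezoid p' q'" unfolding I using v[of "snd x"] by auto
    qed
    moreover have "(real (snd q), 1) \<in> corners p q \<inter> corners p' q'" using 3 by (simp add: corners_def)
    ultimately show ?thesis
      using corner_extreme_point_of_trapezoid assms unfolding meet_properly_def by (auto dest!: less_imp_le)
  next
    case 4
    then have "abscissa v q \<noteq> abscissa v p'" if "0 \<le> v" "v \<le> 1" for v
      using eq[OF that] by auto
    then have "trapezoid p q \<inter> trapezoid p' q' = {}"
      unfolding set_eq_iff I by auto
    then show ?thesis by (simp add: meet_properly_def)
  qed
qed

text \<open>Overlapping slices would give a common interior point. Such a point is no vertex, and a
  face through it is the whole trapezoid, which is not an edge.\<close>

lemma meet_properly_trapezoid_slices:
  assumes "p < q" "p' < q'" "meet_properly (trapezoid p q) (trapezoid p' q')" "0 < v" "v < 1"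
  shows "abscissa v q \<le> abscissa v p' \<or> abscissa v q' \<le> abscissa v p"
proof (rule ccontr)
  assume "\<not> ?thesis"
  then have "max (abscissa v p) (abscissa v p') < min (abscissa v q) (abscissa v q')"
    using abscissa_strict_mono assms by auto
  then obtain u where u: "max (abscissa v p) (abscissa v p') < u" "u < min (abscissa v q) (abscissa v q')"
    using dense by blast
  have int: "(u, v) \<in> interior (trapezoid p q)" "(u, v) \<in> interior (trapezoid p' q')"
    using u assms by (auto intro: interior_trapezoid)
  then have mem: "(u, v) \<in> trapezoid p q \<inter> trapezoid p' q'" using interior_subset by blast
  have "\<not> (u, v) extreme_point_of trapezoid p q" using int(1) extreme_point_not_in_interior by blast
  with assms(3) mem have "trapezoid p q \<inter> trapezoid p' q' edge_of trapezoid p q"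
    unfolding meet_properly_def by (metis empty_iff singletonD)
  with mem obtain e where e: "e edge_of trapezoid p q" "(u, v) \<in> e" by blast
  then have "e = trapezoid p q" using face_of_disjoint_interior int(1) unfolding edge_of_def by blast
  with e show False
    using aff_dim_nonempty_interior[OF interior_trapezoid_nonempty[OF assms(1)]] by (simp add: edge_of_def)
qed

section \<open>Polygons with vertices in the grid\<close>

lemma mem_lattice_grid:
  "x \<in> lattice_grid (Suc m) \<longleftrightarrow> (\<exists>i\<le>m. x = (real i, 0) \<or> x = (real i, 1))"
  unfolding lattice_grid_def by (auto simp: less_Suc_eq_le)

lemma hull_lattice_grid: "convex hull (lattice_grid (Suc m)) = trapezoid (0, 0) (m, m)"
proof
  show "convex hull (lattice_grid (Suc m)) \<subseteq> trapezoid (0, 0) (m, m)"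
    by (intro hull_minimal convex_trapezoid) (auto simp: mem_lattice_grid trapezoid_def)
  have "corners (0, 0) (m, m) \<subseteq> lattice_grid (Suc m)"
    by (force simp: mem_lattice_grid corners_def)
  then show "trapezoid (0, 0) (m, m) \<subseteq> convex hull (lattice_grid (Suc m))"
    by (subst trapezoid_eq_hull) (auto simp: less_eq_prod_def intro!: hull_mono)
qed

text \<open>The vertices lie on the two rows, and both rows occur because otherwise the polygon
  would be flat. The leftmost and rightmost vertices of each row then span it.\<close>

lemma grid_polygon_is_trapezoid:
  assumes "convex_polygon P" "{x. x extreme_point_of P} \<subseteq> lattice_grid (Suc m)"
  obtains p q where "P = trapezoid p q" "p < q" "q \<le> (m, m)"
proof -
  define V where "V = {x. x extreme_point_of P}"
  define R where "R j = {i. i \<le> m \<and> (real i, j) \<in> V}" for j :: real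
  have P: "P = convex hull V"
    using assms(1) Krein_Milman_polytope unfolding convex_polygon_def polytope_def V_def by blast
  have V: "\<exists>i. i \<in> R 0 \<and> x = (real i, 0) \<or> i \<in> R 1 \<and> x = (real i, 1)" if "x \<in> V" for x
  proof -
    have "x \<in> lattice_grid (Suc m)" using that assms(2) by (auto simp: V_def)
    then show ?thesis using that by (auto simp: mem_lattice_grid R_def)
  qed
  have int: "interior P \<noteq> {}" using assms(1) by (simp add: convex_polygon_def)
  have not_row: "\<not> V \<subseteq> {x. (0, 1) \<bullet> x = (j::real)}" for j
  proof
    assume "V \<subseteq> {x. (0, 1) \<bullet> x = j}"
    then have "P \<subseteq> {x. (0, 1) \<bullet> x = j}"
      unfolding P by (intro hull_minimal convex_hyperplane)
    moreover have "interior {x. (0, 1) \<bullet> x = j} = ({} :: (real \<times> real) set)"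
      by (rule interior_hyperplane) (simp add: zero_prod_def)
    ultimately show False using interior_mono int by blast
  qed
  have fin: "finite (R j)" for j by (simp add: R_def)
  have ne: "R 0 \<noteq> {}" "R 1 \<noteq> {}" using not_row[of 1] not_row[of 0] V by force+
  define p where "p = (Min (R 0), Min (R 1))"
  define q where "q = (Max (R 0), Max (R 1))"
  have mem: "Min (R j) \<in> R j" "Max (R j) \<in> R j" if "j \<in> {0, 1}" for j
    using that ne Min_in[OF fin] Max_in[OF fin] by auto
  have pq: "p \<le> q" using ne fin by (auto simp: p_def q_def less_eq_prod_def)
  have PT: "P = trapezoid p q"
  proof
    show "P \<subseteq> trapezoid p q"
      unfolding P using V fin by (intro hull_minimal convex_trapezoid) (fastforce simp: trapezoid_def p_def q_def)
    have "corners p q \<subseteq> V"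
      using mem[of 0] mem[of 1] by (auto simp: corners_def p_def q_def R_def)
    then show "trapezoid p q \<subseteq> P" unfolding P trapezoid_eq_hull[OF pq] by (rule hull_mono)
  qed
  have "p \<noteq> q"
  proof
    assume "p = q"
    then have "P = side p" using PT by (auto simp: trapezoid_def mem_side)
    then show False using int by (simp add: side_def interior_closed_segment_ge2)
  qed
  moreover have "q \<le> (m, m)" using mem by (auto simp: q_def R_def less_eq_prod_def)
  ultimately show ?thesis using that PT pq by (simp add: order.strict_iff_order)
qed

section \<open>Subdivisions and chains\<close>

definition consec :: "(nat \<times> nat) set \<Rightarrow> nat \<times> nat \<Rightarrow> nat \<times> nat \<Rightarrow> bool" where
  "consec C p q \<longleftrightarrow> p \<in> C \<and> q \<in> C \<and> p < q \<and> (\<forall>r\<in>C. \<not> (p < r \<and> r < q))"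

definition tiles :: "(nat \<times> nat) set \<Rightarrow> (real \<times> real) set set" where
  "tiles C = {trapezoid p q | p q. consec C p q}"

section \<open>From a chain to a subdivision\<close>

context
  fixes m :: nat and C :: "(nat \<times> nat) set"
  assumes C: "C \<in> grid_chains_from m (0, 0)"
begin

lemma chain_region: "p \<in> C \<Longrightarrow> fst p \<le> snd p \<and> snd p \<le> m \<and> p \<le> (m, m) \<and> (0, 0) \<le> p"
  using C by (auto simp: grid_chains_from_def less_eq_prod_def)

lemma chain_total: "p \<in> C \<Longrightarrow> q \<in> C \<Longrightarrow> p \<le> q \<or> q \<le> p"
  using C by (auto simp: grid_chains_from_def)

lemma chain_ends: "(0, 0) \<in> C" "(m, m) \<in> C"
  using C by (auto simp: grid_chains_from_def)

lemma finite_chain: "finite C"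
  using C finite_subset[OF _ finite_region] by (auto simp: grid_chains_from_def)

lemma chain_successor:
  assumes "p \<in> C" "p \<noteq> (m, m)"
  shows "\<exists>q. consec C p q"
proof -
  have "(m, m) \<in> {r\<in>C. p < r}"
    using assms chain_ends chain_region by (auto simp: order.strict_iff_order)
  then have "\<exists>q\<in>{r\<in>C. p < r}. \<forall>r\<in>{r\<in>C. p < r}. q \<le> r"
    using finite_chain chain_total by (intro finite_chain_has_least) auto
  then obtain q where "q \<in> {r\<in>C. p < r}" "\<forall>r\<in>{r\<in>C. p < r}. q \<le> r" by blast
  then have "consec C p q" using assms unfolding consec_def by (blast dest: leD)
  then show ?thesis by blast
qed

lemma consec_distinct:
  assumes "consec C p q" "consec C p' q'" "(p, q) \<noteq> (p', q')"
  shows "q \<le> p' \<or> q' \<le> p"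
proof -
  have le: "q \<le> p'" if "consec C p q" "consec C p' q'" "p < p'" for p q p' q'
  proof -
    have "\<not> p' < q" using that by (auto simp: consec_def)
    then show ?thesis using that chain_total[of q p'] by (auto simp: consec_def order.strict_iff_order)
  qed
  have "p \<noteq> p'"
  proof
    assume "p = p'"
    moreover have "\<not> q < q'" "\<not> q' < q" using assms \<open>p = p'\<close> by (auto simp: consec_def)
    ultimately show False
      using assms chain_total[of q q'] by (auto simp: consec_def order.strict_iff_order)
  qed
  then have "p < p' \<or> p' < p"
    using assms chain_total[of p p'] by (auto simp: consec_def order.strict_iff_order)
  then show ?thesis using le assms by blast
qed

lemma Union_tiles:
  assumes "m \<ge> 1"
  shows "\<Union>(tiles C) = trapezoid (0, 0) (m, m)"
proof
  show "\<Union>(tiles C) \<subseteq> trapezoid (0, 0) (m, m)"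
  proof
    fix x assume "x \<in> \<Union>(tiles C)"
    then obtain p q where x: "x \<in> trapezoid p q" and "p \<in> C" "q \<in> C" by (auto simp: tiles_def consec_def)
    then have "abscissa (snd x) (0, 0) \<le> abscissa (snd x) p" "abscissa (snd x) q \<le> abscissa (snd x) (m, m)"
      using chain_region by (intro abscissa_mono; auto simp: trapezoid_def)+
    with x show "x \<in> trapezoid (0, 0) (m, m)" by (cases x) (auto simp: trapezoid_def)
  qed
  show "trapezoid (0, 0) (m, m) \<subseteq> \<Union>(tiles C)"
  proof
    fix x assume "x \<in> trapezoid (0, 0) (m, m)"
    then obtain u v where x: "x = (u, v)" and uv: "0 \<le> v" "v \<le> 1" "0 \<le> u" "u \<le> m"
      by (auto simp: trapezoid_def)
    \<comment> \<open>The tile containing \<open>x\<close> starts at the last segment of the chain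
      that is not to the right of \<open>x\<close>. Excluding \<open>(m, m)\<close> guarantees a
      successor; if that successor is \<open>(m, m)\<close>, then \<open>u\<close> is bounded by
      \<open>m\<close>.\<close>
    define A where "A = {c\<in>C. c \<noteq> (m, m) \<and> abscissa v c \<le> u}"
    have "(0, 0) \<in> A" using chain_ends(1) assms uv by (simp add: A_def)
    then have "A \<noteq> {}" by blast
    have "finite A" using finite_chain by (simp add: A_def)
    then obtain p where p: "p \<in> A" "\<And>r. r \<in> A \<Longrightarrow> p \<le> r \<Longrightarrow> p = r"
      using finite_has_maximal[OF \<open>finite A\<close> \<open>A \<noteq> {}\<close>] by metis
    then have "p \<in> C" "p \<noteq> (m, m)" by (simp_all add: A_def)
    then obtain q where q: "consec C p q" using chain_successor by blast
    then have "q \<notin> A" using p(2)[of q] by (auto simp: consec_def order.strict_iff_order)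
    with q uv have "u \<le> abscissa v q" by (auto simp: A_def consec_def)
    with p uv have "x \<in> trapezoid p q" by (auto simp: x trapezoid_def A_def)
    with q show "x \<in> \<Union>(tiles C)" unfolding tiles_def by blast
  qed
qed

lemma bimonotone_subdivision_tiles:
  assumes "m \<ge> 1"
  shows "bimonotone_subdivision (lattice_grid (Suc m)) (tiles C)"
  unfolding bimonotone_subdivision_def subdivision_def
proof (intro conjI ballI impI)
  fix P assume "P \<in> tiles C"
  then obtain p q where pq: "P = trapezoid p q" "consec C p q" by (auto simp: tiles_def)
  then have "p < q" and region: "p \<in> C" "q \<in> C" by (auto simp: consec_def)
  then show "convex_polygon P" "bimonotone P"
    using chain_region pq by (auto simp: convex_polygon_trapezoid bimonotone_trapezoid)
  have "corners p q \<subseteq> lattice_grid (Suc m)"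
    using region[THEN chain_region] by (auto simp: corners_def mem_lattice_grid)
  then show "{v. v extreme_point_of P} \<subseteq> lattice_grid (Suc m)"
    using extreme_point_of_trapezoid[OF less_imp_le[OF \<open>p < q\<close>]] pq by blast
next
  show "\<Union>(tiles C) = convex hull (lattice_grid (Suc m))"
    using Union_tiles[OF assms] by (simp add: hull_lattice_grid)
next
  fix P Q assume "P \<in> tiles C" "Q \<in> tiles C" "P \<noteq> Q"
  then obtain p q p' q' where PQ: "P = trapezoid p q" "Q = trapezoid p' q'"
    and consec: "consec C p q" "consec C p' q'" unfolding tiles_def by blast
  then have "q \<le> p' \<or> q' \<le> p" using consec_distinct \<open>P \<noteq> Q\<close> by blast
  then have "meet_properly P Q \<or> meet_properly Q P"
    using trapezoid_meet_properly consec unfolding PQ consec_def by blast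
  then show "meet_properly P Q" unfolding meet_properly_def by (auto simp: Int_commute)
qed

lemma consec_iff_tile: "consec C p q \<longleftrightarrow> p < q \<and> trapezoid p q \<in> tiles C"
proof
  assume *: "p < q \<and> trapezoid p q \<in> tiles C"
  then obtain p' q' where "consec C p' q'" "trapezoid p q = trapezoid p' q'" by (auto simp: tiles_def)
  moreover from this have "p = p' \<and> q = q'"
    using * by (intro trapezoid_inj) (auto simp: consec_def less_imp_le)
  ultimately show "consec C p q" by simp
next
  assume "consec C p q"
  then show "p < q \<and> trapezoid p q \<in> tiles C" unfolding tiles_def consec_def by blast
qed

text \<open>For \<open>m \<ge> 1\<close> the chain has two distinct elements, so each element
  belongs to a consecutive pair. Hence the consecutive pairs, and with them the tiles, determine the
  chain.\<close>

lemma chain_eq_endpoints: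
  assumes "m \<ge> 1"
  shows "C = {p. \<exists>q. consec C p q \<or> consec C q p}"
proof (intro equalityI subsetI)
  fix p assume p: "p \<in> C"
  show "p \<in> {p. \<exists>q. consec C p q \<or> consec C q p}"
  proof (cases "p = (m, m)")
    case True
    have "(0, 0) \<in> C - {p}" using assms chain_ends True by auto
    then obtain q where q: "q \<in> C - {p}" "\<And>r. r \<in> C - {p} \<Longrightarrow> q \<le> r \<Longrightarrow> q = r"
      using finite_has_maximal[of "C - {p}"] finite_chain by (metis emptyE finite_Diff)
    then obtain s where s: "consec C q s" using chain_successor True by blast
    then have "s = p" using q(2)[of s] by (auto simp: consec_def order.strict_iff_order)
    with s show ?thesis by blast
  next
    case False
    then show ?thesis using chain_successor p by blast
  qed
qed (auto simp: consec_def)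

end

lemma tiles_inj: "m \<ge> 1 \<Longrightarrow> inj_on tiles (grid_chains_from m (0, 0))"
proof (rule inj_onI)
  fix C D assume *: "m \<ge> 1" "C \<in> grid_chains_from m (0, 0)" "D \<in> grid_chains_from m (0, 0)"
    "tiles C = tiles D"
  have "consec C p q \<longleftrightarrow> consec D p q" for p q
    using * by (simp add: consec_iff_tile)
  then show "C = D"
    using chain_eq_endpoints[OF *(2,1)] chain_eq_endpoints[OF *(3,1)] by simp
qed

section \<open>From a subdivision to a chain\<close>

lemma ex_irrational_between_0_1: "\<exists>v::real. 0 < v \<and> v < 1 \<and> v \<notin> \<rat>"
proof (rule ccontr)
  assume "\<not> ?thesis"
  then have "{0<..<1::real} \<subseteq> \<rat>" by auto
  then have "countable {0<..<1::real}" using countable_rat countable_subset by blast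
  then show False using uncountable_open_interval[of 0 "1::real"] by simp
qed

text \<open>On a horizontal line of irrational height the abscissa determines the segment
  through it, so the tiling of that line by the polygons already determines the chain.\<close>

definition height :: real where
  "height = (SOME v. 0 < v \<and> v < 1 \<and> v \<notin> \<rat>)"

lemma height: "0 < height" "height < 1" "height \<notin> \<rat>"
  using someI_ex[OF ex_irrational_between_0_1] by (simp_all add: height_def)

context
  fixes m :: nat and T :: "(real \<times> real) set set"
  assumes m: "m \<ge> 1" and T: "bimonotone_subdivision (lattice_grid (Suc m)) T"
begin

definition tile_pairs :: "((nat \<times> nat) \<times> (nat \<times> nat)) set" where
  "tile_pairs = {(p, q). p < q \<and> trapezoid p q \<in> T}"

definition tile_ends :: "(nat \<times> nat) set" where
  "tile_ends = {p. \<exists>q. (p, q) \<in> tile_pairs \<or> (q, p) \<in> tile_pairs}"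

lemma subdivision_trapezoid:
  assumes "P \<in> T"
  obtains p q where "P = trapezoid p q" "(p, q) \<in> tile_pairs" "fst p \<le> snd p" "fst q \<le> snd q" "q \<le> (m, m)"
proof -
  obtain p q where pq: "P = trapezoid p q" "p < q" "q \<le> (m, m)"
    using T assms grid_polygon_is_trapezoid[of P m]
    unfolding bimonotone_subdivision_def subdivision_def by metis
  moreover have "fst p \<le> snd p \<and> fst q \<le> snd q"
    using T assms pq bimonotone_trapezoid unfolding bimonotone_subdivision_def by blast
  ultimately show ?thesis using that assms by (auto simp: tile_pairs_def)
qed

text \<open>By \<open>trapezoid_inj\<close> the representation of a tile is unique, so what
  \<open>subdivision_trapezoid\<close> says of some pair holds for the given one.\<close>

lemma tile_pairsD:
  assumes "(p, q) \<in> tile_pairs"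
  shows "p < q" "trapezoid p q \<in> T" "fst p \<le> snd p" "fst q \<le> snd q" "p \<le> (m, m)" "q \<le> (m, m)"
    "p \<in> tile_ends" "q \<in> tile_ends"
proof -
  show pq: "p < q" "trapezoid p q \<in> T" using assms by (auto simp: tile_pairs_def)
  show "p \<in> tile_ends" "q \<in> tile_ends" using assms unfolding tile_ends_def by blast+
  obtain p' q' where "trapezoid p q = trapezoid p' q'" "(p', q') \<in> tile_pairs"
    and region: "fst p' \<le> snd p'" "fst q' \<le> snd q'" "q' \<le> (m, m)"
    using subdivision_trapezoid[OF pq(2)] by blast
  then have "p = p'" "q = q'" using trapezoid_inj[of p q p' q'] pq(1) by (auto simp: tile_pairs_def)
  with region pq(1) show "fst p \<le> snd p" "fst q \<le> snd q" "p \<le> (m, m)" "q \<le> (m, m)" by auto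
qed

lemma tile_endsD: "p \<in> tile_ends \<Longrightarrow> fst p \<le> snd p \<and> p \<le> (m, m)"
  using tile_pairsD unfolding tile_ends_def by blast

lemma finite_tile_ends: "finite tile_ends"
proof (rule finite_subset)
  show "tile_ends \<subseteq> {(a, c). a \<le> c \<and> c \<le> m}"
    using tile_endsD by (auto simp: less_eq_prod_def)
qed (rule finite_region)

abbreviation pos :: "nat \<times> nat \<Rightarrow> real" where
  "pos \<equiv> abscissa height"

lemma pos_less: "p < q \<Longrightarrow> pos p < pos q"
  by (rule abscissa_strict_mono) (use height in auto)

lemma pos_le: "p \<le> q \<Longrightarrow> pos p \<le> pos q"
  by (rule abscissa_mono) (use height in auto)

lemma pos_inj: "pos p = pos q \<Longrightarrow> p = q"
  using abscissa_inj height by blast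

text \<open>On the line at \<open>height\<close> the tiles become intervals that do not overlap;
  with the covering of \<open>[0, m]\<close> below, they tile a segment.\<close>

lemma tile_pairs_distinct:
  assumes "(p, q) \<in> tile_pairs" "(p', q') \<in> tile_pairs" "(p, q) \<noteq> (p', q')"
  shows "pos q \<le> pos p' \<or> pos q' \<le> pos p"
proof (rule meet_properly_trapezoid_slices)
  show lt: "p < q" "p' < q'" using assms by (auto simp: tile_pairs_def)
  then have "trapezoid p q \<noteq> trapezoid p' q'" using trapezoid_inj[OF _ lt[THEN less_imp_le]] assms(3) by auto
  moreover have "trapezoid p q \<in> T" "trapezoid p' q' \<in> T" using assms by (auto simp: tile_pairs_def)
  ultimately show "meet_properly (trapezoid p q) (trapezoid p' q')"
    using T by (simp add: bimonotone_subdivision_def subdivision_def)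
qed (use height in auto)

lemma tile_pairs_cover:
  assumes "0 \<le> u" "u \<le> real m"
  obtains p q where "(p, q) \<in> tile_pairs" "pos p \<le> u" "u \<le> pos q"
proof -
  have "(u, height) \<in> trapezoid (0, 0) (m, m)"
    using assms height by (auto simp: trapezoid_def)
  then have "(u, height) \<in> \<Union>T"
    using T by (simp add: bimonotone_subdivision_def subdivision_def hull_lattice_grid)
  then obtain p q where "(p, q) \<in> tile_pairs" "(u, height) \<in> trapezoid p q"
    using subdivision_trapezoid by blast
  then show ?thesis using that by (auto simp: trapezoid_def)
qed

text \<open>The end \<open>c\<close> belongs to an interval of its own, which would overlap the
  given one.\<close>

lemma no_tile_end_between:
  assumes "(p, q) \<in> tile_pairs" "c \<in> tile_ends"
  shows "\<not> (pos p < pos c \<and> pos c < pos q)"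
proof
  assume *: "pos p < pos c \<and> pos c < pos q"
  from assms(2) consider d where "(c, d) \<in> tile_pairs" | d where "(d, c) \<in> tile_pairs"
    unfolding tile_ends_def by blast
  then show False
  proof cases
    case 1
    then show ?thesis
      using tile_pairs_distinct[OF assms(1) 1] * pos_less[OF tile_pairsD(1)[OF 1]] by auto
  next
    case 2
    then show ?thesis
      using tile_pairs_distinct[OF assms(1) 2] * pos_less[OF tile_pairsD(1)[OF 2]] by auto
  qed
qed

lemma tile_end_successor:
  assumes "c \<in> tile_ends" "c \<noteq> (m, m)"
  obtains q where "(c, q) \<in> tile_pairs"
proof -
  \<comment> \<open>A point \<open>u\<close> is chosen to the right of \<open>c\<close> and before
    any further end. The bound \<open>real m\<close> keeps \<open>S\<close> nonempty and
    \<open>u\<close> inside the covered range. The tile over \<open>u\<close> must start at the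
    position of \<open>c\<close>, hence at \<open>c\<close>.\<close>
  define S where "S = {s \<in> insert (real m) (pos ` tile_ends). pos c < s}"
  have "c < (m, m)" using tile_endsD[OF assms(1)] assms(2) by (simp add: order.strict_iff_order)
  then have "pos c < real m" using pos_less[of c "(m, m)"] by simp
  then have S: "finite S" "real m \<in> S" using finite_tile_ends by (auto simp: S_def)
  then have "Min S \<in> S" by (intro Min_in) auto
  then have "pos c < Min S" unfolding S_def by blast
  then obtain u where u: "pos c < u" "u < Min S" using dense by blast
  have gap: "pos r \<le> pos c" if "r \<in> tile_ends" "pos r \<le> u" for r
    using that u Min_le[OF S(1), of "pos r"] by (force simp: S_def)
  have "0 \<le> pos c" using pos_le[of "(0, 0)" c] by (auto simp: less_eq_prod_def)
  moreover have "Min S \<le> real m" by (rule Min_le[OF S])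
  ultimately have "0 \<le> u" "u \<le> real m" using u by auto
  then obtain p q where pq: "(p, q) \<in> tile_pairs" "pos p \<le> u" "u \<le> pos q"
    using tile_pairs_cover by blast
  then have "pos p \<le> pos c" using gap tile_pairsD(7) by blast
  then have "pos p = pos c" using no_tile_end_between[OF pq(1) assms(1)] pq(3) u by auto
  then show ?thesis using that pq pos_inj by blast
qed

text \<open>Order at a single height does not in general imply the product order. Here the two ends
  are linked by successive tiles, and each tile increases in the product order.\<close>

lemma tile_ends_mono:
  assumes "p \<in> tile_ends" "q \<in> tile_ends" "pos p \<le> pos q"
  shows "p \<le> q"
  using assms
proof (induction "card {r\<in>tile_ends. pos p < pos r}" arbitrary: p rule: less_induct)
  case less
  show ?case
  proof (cases "pos p = pos q")
    case True
    then show ?thesis using pos_inj by blast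
  next
    case False
    then have lt: "pos p < pos q" using less.prems by simp
    have "q \<le> (m, m)" using less.prems tile_endsD by blast
    then have "p \<noteq> (m, m)" using lt pos_le[of q p] by auto
    then obtain s where s: "(p, s) \<in> tile_pairs" using tile_end_successor less.prems by blast
    have ps: "p < s" "s \<in> tile_ends" using tile_pairsD[OF s] by auto
    have "pos s \<le> pos q" using no_tile_end_between[OF s less.prems(2)] lt by auto
    moreover have "{r\<in>tile_ends. pos s < pos r} \<subset> {r\<in>tile_ends. pos p < pos r}"
      using pos_less[OF ps(1)] ps(2) by auto
    then have "card {r\<in>tile_ends. pos s < pos r} < card {r\<in>tile_ends. pos p < pos r}"
      using finite_tile_ends by (intro psubset_card_mono) auto
    ultimately have "s \<le> q" using less.hyps ps less.prems by blast
    then show ?thesis using ps by simp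
  qed
qed

lemma tile_ends_chain: "tile_ends \<in> grid_chains_from m (0, 0)"
proof -
  \<comment> \<open>The tiles over the two extreme points of the slice at \<open>height\<close>
    supply \<open>(0, 0)\<close> and \<open>(m, m)\<close>.\<close>
  obtain p q where pq: "(p, q) \<in> tile_pairs" "pos p \<le> 0"
    using tile_pairs_cover[OF order.refl of_nat_0_le_iff] by blast
  have "pos (0, 0) \<le> pos p" by (rule pos_le) (simp add: less_eq_prod_def)
  then have "p = (0, 0)" using pq(2) by (intro pos_inj) simp
  then have bot: "(0, 0) \<in> tile_ends" using pq tile_pairsD by blast
  obtain p q where pq: "(p, q) \<in> tile_pairs" "real m \<le> pos q"
    using tile_pairs_cover[OF of_nat_0_le_iff order.refl] by blast
  have "pos q \<le> pos (m, m)" using pq tile_pairsD by (intro pos_le) blast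
  then have "q = (m, m)" using pq(2) by (intro pos_inj) simp
  then have top: "(m, m) \<in> tile_ends" using pq tile_pairsD by blast
  have "p \<le> q \<or> q \<le> p" if "p \<in> tile_ends" "q \<in> tile_ends" for p q
    using tile_ends_mono that by (meson linear)
  moreover have "tile_ends \<subseteq> {(a, c). a \<le> c \<and> c \<le> m}"
    using tile_endsD by (auto simp: less_eq_prod_def)
  ultimately show ?thesis
    unfolding grid_chains_from_def using bot top by (simp add: less_eq_prod_def)
qed

lemma tiles_tile_ends: "tiles tile_ends = T"
proof -
  have "consec tile_ends p q \<longleftrightarrow> (p, q) \<in> tile_pairs" for p q
  proof
    assume pq: "(p, q) \<in> tile_pairs"
    have "\<not> (p < r \<and> r < q)" if "r \<in> tile_ends" for r
      using no_tile_end_between[OF pq that] pos_less by blast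
    then show "consec tile_ends p q"
      using tile_pairsD[OF pq] unfolding consec_def by blast
  next
    assume pq: "consec tile_ends p q"
    then have ends: "p \<in> tile_ends" "q \<in> tile_ends" "p < q" by (auto simp: consec_def)
    then have "p \<noteq> (m, m)" using tile_endsD[OF ends(2)] by (blast dest: leD)
    then obtain s where s: "(p, s) \<in> tile_pairs" using tile_end_successor ends by blast
    \<comment> \<open>The tile starting at \<open>p\<close> ends at some \<open>s\<close>. It cannot
      pass \<open>q\<close>, which is an end, and cannot stop before \<open>q\<close>, since
      \<open>p\<close> and \<open>q\<close> are consecutive.\<close>
    have "pos s = pos q"
    proof (rule antisym)
      show "pos s \<le> pos q"
        using no_tile_end_between[OF s ends(2)] pos_less[OF ends(3)] by linarith
      show "pos q \<le> pos s"
      proof (rule ccontr)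
        assume "\<not> ?thesis"
        then have "s < q" using tile_ends_mono[of s q] ends tile_pairsD[OF s]
          by (auto simp: order.strict_iff_order)
        then show False using pq tile_pairsD[OF s] unfolding consec_def by blast
      qed
    qed
    then show "(p, q) \<in> tile_pairs" using s pos_inj by blast
  qed
  then have "tiles tile_ends = {trapezoid p q | p q. (p, q) \<in> tile_pairs}" by (simp add: tiles_def)
  also have "\<dots> = T"
  proof (intro equalityI subsetI)
    fix P assume "P \<in> T"
    then show "P \<in> {trapezoid p q | p q. (p, q) \<in> tile_pairs}" using subdivision_trapezoid by blast
  next
    fix P assume "P \<in> {trapezoid p q | p q. (p, q) \<in> tile_pairs}"
    then show "P \<in> T" using tile_pairsD(2) by blast
  qed
  finally show ?thesis .
qed

end

theorem theorem3:
  fixes n :: nat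
  assumes "n \<ge> 2"
  shows "card {T. bimonotone_subdivision (lattice_grid n) T} = 2 ^ (n - 2) * large_schroeder (n - 1)"
proof -
  obtain m where n: "n = Suc m" "m \<ge> 1" using assms by (cases n) auto
  \<comment> \<open>A subdivision \<open>T\<close> is hit because it is the tiling of its own chain
    \<open>tile_ends\<close>.\<close>
  have "tiles ` grid_chains_from m (0, 0) = {T. bimonotone_subdivision (lattice_grid n) T}"
    using n bimonotone_subdivision_tiles tile_ends_chain tiles_tile_ends by blast
  then have "card {T. bimonotone_subdivision (lattice_grid n) T} = card (grid_chains_from m (0, 0))"
    using card_image[OF tiles_inj[OF n(2)]] by simp
  then show ?thesis using card_grid_chains[OF n(2)] n by (simp add: numeral_2_eq_2)
qed

end
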